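(* Let $f\colon X\to Y$ and $f'\colon X'\to Y$ be maps, and assume that there exist fibrewise maps $u\colon X\to X'$ and $v\colon X'\to X$ (that is, continuous maps with $f'u=f$ and $fv=f'$) that are homotopy inverses of each other (i.e. $vu\simeq 1_X$ and $uv\simeq 1_{X'}$). Then $\mathrm{TC}(f)=\mathrm{TC}(f')$. In particular, topological complexity is a fibre homotopy equivalence invariant: if $f$ and $f'$ are fibre homotopy equivalent over $Y$, then $\mathrm{TC}(f)=\mathrm{TC}(f')$.
   Context: All spaces are path-connected metric absolute neighbourhood retracts, and $f,f'$ are continuous surjections. Two maps $f\colon X\to Y$ and $f'\colon X'\to Y$ are fibre homotopy equivalent if there are continuous maps $u\colon X\to X'$, $v\colon X'\to X$ with $f'u=f$, $fv=f'$ such that $uv$ and $vu$ are homotopic to the respective identity maps by fibre-preserving homotopies. Let $I=[0,1]$ and let $X^I$ be the space of continuous paths in $X$ with the compact-open topology. For a continuous surjection $p\colon E\to B$, the sectional number $\mathrm{sec}(p)$ is the minimal integer $n$ for which there is an increasing sequence of open subsets $\emptyset=U_0\subseteq U_1\subseteq\cdots\subseteq U_n=B$ such that for each $i=1,\dots,n$ there is a continuous map $s\colon U_i-U_{i-1}\to E$ with $p(s(b))=b$ for all $b$; if no such $n$ exists, $\mathrm{sec}(p)=\infty$. For a continuous surjection $f\colon X\to Y$ between path-connected spaces, $\mathrm{TC}(f)=\mathrm{sec}(\pi_f)$, where $\pi_f\colon X^I\to X\times Y$, $\pi_f(\alpha)=(\alpha(0),f(\alpha(1)))$. *)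

theory Defs
  imports "HOL-Analysis.Analysis" "HOL-Library.Extended_Nat"
begin

(* A metrizable space X is an ANR if every homeomorphic copy of X that is closed in a
   metrizable space Z is a retract of an open neighbourhood in Z.  HOL cannot quantify over
   all types, so Z ranges over the metrizable topologies on subsets of 'a => real.  This is no
   restriction: for a bounded metric d inducing X (with values d(x,y) extended by 0), the
   Kuratowski-Wojdyslawski embedding sends x to the function d(x,-) and is a homeomorphism
   onto a closed subset of the convex hull Z of its image, a metrizable space carried by
   'a => real; by Dugundji's extension theorem, being a neighbourhood retract of this single
   Z already makes X an ANR with respect to all metrizable spaces.  The library's constant
   ANR is unsuitable, since it is meant for subsets of Euclidean spaces only. *)
definition metric_ANR :: "'a topology \<Rightarrow> bool" where
  "metric_ANR X \<longleftrightarrow> metrizable_space X \<and>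
     (\<forall>(Z :: ('a \<Rightarrow> real) topology) C.
        metrizable_space Z \<and> closedin Z C \<and> subtopology Z C homeomorphic_space X \<longrightarrow>
        (\<exists>W. openin Z W \<and> C \<subseteq> W \<and> C retract_of_space (subtopology Z W)))"

definition continuous_surjection :: "'a topology \<Rightarrow> 'b topology \<Rightarrow> ('a \<Rightarrow> 'b) \<Rightarrow> bool" where
  "continuous_surjection X Y f \<longleftrightarrow> continuous_map X Y f \<and> f ` topspace X = topspace Y"

(* Extensionality pins down the values of a path outside the unit interval, so that each
   path in X is represented by exactly one function. *)
definition paths :: "'a topology \<Rightarrow> (real \<Rightarrow> 'a) set" where
  "paths X = {\<alpha> \<in> extensional {0..1}. pathin X \<alpha>}"

definition path_space :: "'a topology \<Rightarrow> (real \<Rightarrow> 'a) topology" where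
  "path_space X = topology_generated_by
     {{\<alpha> \<in> paths X. \<alpha> ` K \<subseteq> V} | K V. compact K \<and> K \<subseteq> {0..1} \<and> openin X V}"

lemma topspace_path_space: "topspace (path_space X) = paths X"
proof -
  have "paths X = {\<alpha> \<in> paths X. \<alpha> ` {} \<subseteq> {}}"
    by simp
  then have "paths X \<in> {{\<alpha> \<in> paths X. \<alpha> ` K \<subseteq> V} | K V. compact K \<and> K \<subseteq> {0..1} \<and> openin X V}"
    using compact_empty openin_empty by blast
  then show ?thesis
    unfolding path_space_def topology_generated_by_topspace by blast
qed

(* The infimum of the empty set of extended naturals is infinity; a nonempty set attains it. *)
definition sectional_number :: "'e topology \<Rightarrow> 'b topology \<Rightarrow> ('e \<Rightarrow> 'b) \<Rightarrow> enat" where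
  "sectional_number E B p = Inf {enat n | n. \<exists>U :: nat \<Rightarrow> 'b set.
     U 0 = {} \<and> U n = topspace B \<and> (\<forall>i\<le>n. openin B (U i)) \<and>
     (\<forall>i\<in>{1..n}. U (i - 1) \<subseteq> U i \<and>
        (\<exists>s. continuous_map (subtopology B (U i - U (i - 1))) E s \<and>
             (\<forall>b \<in> U i - U (i - 1). p (s b) = b)))}"

definition TC :: "'a topology \<Rightarrow> 'b topology \<Rightarrow> ('a \<Rightarrow> 'b) \<Rightarrow> enat" where
  "TC X Y f = sectional_number (path_space X) (prod_topology X Y) (\<lambda>\<alpha>. (\<alpha> 0, f (\<alpha> 1)))"

definition fibrewise_map ::
  "'a topology \<Rightarrow> ('a \<Rightarrow> 'y) \<Rightarrow> 'b topology \<Rightarrow> ('b \<Rightarrow> 'y) \<Rightarrow> ('a \<Rightarrow> 'b) \<Rightarrow> bool" where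
  "fibrewise_map X f X' f' u \<longleftrightarrow> continuous_map X X' u \<and> (\<forall>x \<in> topspace X. f' (u x) = f x)"

(* homotopic_with P requires every stage of the homotopy to satisfy P; here every stage is
   over Y, i.e. the homotopy is fibre-preserving. *)
definition fibre_homotopy_equivalent ::
  "'a topology \<Rightarrow> ('a \<Rightarrow> 'y) \<Rightarrow> 'b topology \<Rightarrow> ('b \<Rightarrow> 'y) \<Rightarrow> bool" where
  "fibre_homotopy_equivalent X f X' f' \<longleftrightarrow>
     (\<exists>u v. fibrewise_map X f X' f' u \<and> fibrewise_map X' f' X f v \<and>
        homotopic_with (\<lambda>h. \<forall>x \<in> topspace X. f (h x) = f x) X X (v \<circ> u) id \<and>
        homotopic_with (\<lambda>h. \<forall>x \<in> topspace X'. f' (h x) = f' x) X' X' (u \<circ> v) id)"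

end

theory Submission
  imports Defs
begin

text \<open>
  A motion plan for \<open>f'\<close> is transported to \<open>f\<close>: given \<open>(x, y)\<close>, run the homotopy from \<open>x\<close> to
  \<open>v (u x)\<close> and then the \<open>v\<close>-image of the path planned for \<open>(u x, y)\<close>. The endpoint lies over
  \<open>y\<close> because \<open>v\<close> is fibrewise, so a single homotopy \<open>v \<circ> u \<simeq> id\<close>, which need not be
  fibre-preserving, gives one inequality; the other one follows by symmetry.
\<close>

section \<open>Sectional number and pullback of filtrations\<close>

text \<open>Preimages under \<open>g\<close> of an open filtration form an open filtration of the
  same length, and preimages commute with differences. Hence it suffices to convert sections one
  stratum at a time, which is what \<open>lift\<close> provides.\<close>

lemma sectional_number_le_pullback:
  fixes B :: "'b topology" and B' :: "'d topology"
  assumes g: "continuous_map B B' g"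
    and lift: "\<And>C s'. \<lbrakk>C \<subseteq> topspace B'; continuous_map (subtopology B' C) E' s'; \<forall>b\<in>C. p' (s' b) = b\<rbrakk>
      \<Longrightarrow> \<exists>s. continuous_map (subtopology B {b \<in> topspace B. g b \<in> C}) E s \<and>
            (\<forall>b \<in> topspace B. g b \<in> C \<longrightarrow> p (s b) = b)"
  shows "sectional_number E B p \<le> sectional_number E' B' p'"
  unfolding sectional_number_def
\<comment> \<open>Every length feasible for \<open>B'\<close> is feasible for \<open>B\<close>, and
  the infimum over the larger set is smaller; this includes the case where no length is feasible for
  \<open>B'\<close>.\<close>
proof (rule Inf_superset_mono, clarify, intro exI conjI)
  fix n and U :: "nat \<Rightarrow> 'd set"
  assume U: "U 0 = {}" "U n = topspace B'" "\<forall>i\<le>n. openin B' (U i)"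
    "\<forall>i\<in>{1..n}. U (i - 1) \<subseteq> U i \<and>
        (\<exists>s. continuous_map (subtopology B' (U i - U (i - 1))) E' s \<and>
             (\<forall>b \<in> U i - U (i - 1). p' (s b) = b))"
  define W where "W i = {b \<in> topspace B. g b \<in> U i}" for i
  show "enat n = enat n" ..
  show "W 0 = {}" "W n = topspace B"
    using U(1,2) continuous_map_funspace[OF g] by (auto simp: W_def)
  show "\<forall>i\<le>n. openin B (W i)"
    using U(3) g by (simp add: W_def openin_continuous_map_preimage)
  show "\<forall>i\<in>{1..n}. W (i - 1) \<subseteq> W i \<and>
        (\<exists>s. continuous_map (subtopology B (W i - W (i - 1))) E s \<and>
             (\<forall>b \<in> W i - W (i - 1). p (s b) = b))"
  proof
    fix i assume i: "i \<in> {1..n}"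
    let ?C = "U i - U (i - 1)"
    obtain s' where s': "continuous_map (subtopology B' ?C) E' s'" "\<forall>b\<in>?C. p' (s' b) = b"
      and mono: "U (i - 1) \<subseteq> U i"
      using U(4) i by blast
    have "?C \<subseteq> topspace B'"
      using U(3) i openin_subset[of B' "U i"] by auto
    from lift[OF this s'] obtain s
      where "continuous_map (subtopology B {b \<in> topspace B. g b \<in> ?C}) E s"
        and "\<forall>b \<in> topspace B. g b \<in> ?C \<longrightarrow> p (s b) = b"
      by blast
    moreover have "W i - W (i - 1) = {b \<in> topspace B. g b \<in> ?C}"
      by (auto simp: W_def)
    ultimately show "W (i - 1) \<subseteq> W i \<and>
        (\<exists>s. continuous_map (subtopology B (W i - W (i - 1))) E s \<and>
             (\<forall>b \<in> W i - W (i - 1). p (s b) = b))"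
      using mono by (auto simp: W_def)
  qed
qed

section \<open>Continuity in the compact-open topology\<close>

text \<open>Continuity may be tested on a generating family, and the sets in the second assumption
  are the preimages of the generators.\<close>

lemma continuous_map_into_path_space:
  assumes "\<And>z. z \<in> topspace Z \<Longrightarrow> g z \<in> paths X"
    and "\<And>K V. \<lbrakk>compact K; K \<subseteq> {0..1}; openin X V\<rbrakk> \<Longrightarrow> openin Z {z \<in> topspace Z. g z ` K \<subseteq> V}"
  shows "continuous_map Z (path_space X) g"
  unfolding path_space_def
proof (rule continuous_on_generated_topo)
  fix T
  assume "T \<in> {{\<alpha> \<in> paths X. \<alpha> ` K \<subseteq> V} | K V. compact K \<and> K \<subseteq> {0..1} \<and> openin X V}"
  then obtain K V where T: "T = {\<alpha> \<in> paths X. \<alpha> ` K \<subseteq> V}"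
    and KV: "compact K" "K \<subseteq> {0..1}" "openin X V"
    by blast
  have "g -` T \<inter> topspace Z = {z \<in> topspace Z. g z ` K \<subseteq> V}"
    using assms(1) by (auto simp: T)
  with assms(2)[OF KV] show "openin Z (g -` T \<inter> topspace Z)"
    by simp
next
  \<comment> \<open>The generators must also cover the values of \<open>g\<close>; their union is
    the whole of \<open>paths X\<close>.\<close>
  show "g ` topspace Z \<subseteq> \<Union> {{\<alpha> \<in> paths X. \<alpha> ` K \<subseteq> V} | K V. compact K \<and> K \<subseteq> {0..1} \<and> openin X V}"
    using assms(1) topspace_path_space[of X]
    unfolding path_space_def topology_generated_by_topspace by blast
qed

lemma openin_path_space_subbasic:
  assumes "compact K" "K \<subseteq> {0..1}" "openin X V"
  shows "openin (path_space X) {\<alpha> \<in> paths X. \<alpha> ` K \<subseteq> V}"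
  unfolding path_space_def using assms by (intro topology_generated_by_Basis) blast

lemma openin_path_space_preimage:
  assumes "continuous_map Z (path_space X) g" and "compact K" "K \<subseteq> {0..1}" "openin X V"
  shows "openin Z {z \<in> topspace Z. g z ` K \<subseteq> V}"
proof -
  have "openin Z {z \<in> topspace Z. g z \<in> {\<alpha> \<in> paths X. \<alpha> ` K \<subseteq> V}}"
    by (rule openin_continuous_map_preimage[OF assms(1) openin_path_space_subbasic[OF assms(2-4)]])
  moreover have "g z \<in> paths X" if "z \<in> topspace Z" for z
    using continuous_map_funspace[OF assms(1)] that by (auto simp: topspace_path_space)
  ultimately show ?thesis
    by (auto elim!: back_subst[where P = "openin Z"])
qed

text \<open>The preimage of the generator given by \<open>K\<close> and \<open>V\<close> is the
  generator given by \<open>K\<close> and the preimage of \<open>V\<close> under \<open>g\<close>.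
  The restriction to the unit interval keeps the composite extensional.\<close>

lemma continuous_map_path_space_compose:
  assumes g: "continuous_map X Y g"
  shows "continuous_map (path_space X) (path_space Y) (\<lambda>\<alpha>. \<lambda>t\<in>{0..1}. g (\<alpha> t))"
proof (rule continuous_map_into_path_space)
  fix \<alpha> assume "\<alpha> \<in> topspace (path_space X)"
  then have "continuous_map (top_of_set {0..1}) Y (\<lambda>t. g (\<alpha> t))"
    using g by (auto simp: topspace_path_space paths_def pathin_def
      intro: continuous_map_compose[unfolded o_def])
  then show "(\<lambda>t\<in>{0..1}. g (\<alpha> t)) \<in> paths Y"
    by (auto simp: paths_def pathin_def elim: continuous_map_eq)
next
  fix K :: "real set" and V
  assume KV: "compact K" "K \<subseteq> {0..1}" "openin Y V"
  let ?W = "{x \<in> topspace X. g x \<in> V}"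
  have "openin X ?W"
    using g KV(3) by (rule openin_continuous_map_preimage)
  moreover
  have "\<alpha> t \<in> topspace X" if "\<alpha> \<in> paths X" "t \<in> K" for \<alpha> t
    using that KV(2) by (auto simp: paths_def pathin_def continuous_map_def)
  then have "{\<alpha> \<in> topspace (path_space X). (\<lambda>t\<in>{0..1}. g (\<alpha> t)) ` K \<subseteq> V} = {\<alpha> \<in> paths X. \<alpha> ` K \<subseteq> ?W}"
    using KV(2) by (auto simp: topspace_path_space image_subset_iff subset_iff)
  ultimately show "openin (path_space X)
      {\<alpha> \<in> topspace (path_space X). (\<lambda>t\<in>{0..1}. g (\<alpha> t)) ` K \<subseteq> V}"
    using openin_path_space_subbasic[OF KV(1,2), of X ?W] by simp
qed

text \<open>One direction of the exponential law, proved by the tube lemma; it turns a homotopy into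
  a continuous family of paths.\<close>

lemma continuous_map_path_space_curry:
  assumes h: "continuous_map (prod_topology (top_of_set {0..1}) Z) X h"
  shows "continuous_map Z (path_space X) (\<lambda>z. \<lambda>t\<in>{0..1}. h (t, z))"
proof (rule continuous_map_into_path_space)
  fix z assume "z \<in> topspace Z"
  then have "continuous_map (top_of_set {0..1}) (prod_topology (top_of_set {0..1}) Z) (\<lambda>t. (t, z))"
    by (simp add: continuous_map_pairedI)
  from continuous_map_compose[OF this h] show "(\<lambda>t\<in>{0..1}. h (t, z)) \<in> paths X"
    by (auto simp: paths_def pathin_def elim: continuous_map_eq)
next
  fix K :: "real set" and V
  assume KV: "compact K" "K \<subseteq> {0..1}" "openin X V"
  let ?P = "prod_topology (top_of_set K) Z"
  \<comment> \<open>Time is restricted to \<open>K\<close>, so that the first factor becomes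
    compact.\<close>
  have "continuous_map ?P (prod_topology (top_of_set {0..1}) Z) id"
    unfolding continuous_map_pairwise
  proof
    have "continuous_map (top_of_set K) (top_of_set {0..1}) id"
      using KV(2) by auto
    from continuous_map_compose[OF continuous_map_fst this]
    show "continuous_map ?P (top_of_set {0..1}) (fst \<circ> id)"
      by simp
  qed (simp add: continuous_map_snd)
  from continuous_map_compose[OF this h] have "continuous_map ?P X h"
    by simp
  \<comment> \<open>The bad parameters are those \<open>z\<close> with \<open>h (t, z)\<close>
    outside \<open>V\<close> for some \<open>t\<close> in \<open>K\<close>. They are the projection
    of a closed set along a compact factor, hence closed.\<close>
  then have "closedin ?P {w \<in> topspace ?P. h w \<in> topspace X - V}"
    using KV(3) by (intro closedin_continuous_map_preimage) auto
  moreover have "closed_map ?P Z snd"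
    using KV(1) by (intro closed_map_snd) (simp add: compact_space_subtopology)
  ultimately have "closedin Z (snd ` {w \<in> topspace ?P. h w \<in> topspace X - V})"
    by (simp add: closed_map_def)
  then have "openin Z (topspace Z - snd ` {w \<in> topspace ?P. h w \<in> topspace X - V})"
    by blast
  moreover
  have "h (t, z) \<in> topspace X" if "t \<in> K" "z \<in> topspace Z" for t z
    using continuous_map_funspace[OF h] KV(2) that by auto
  then have "topspace Z - snd ` {w \<in> topspace ?P. h w \<in> topspace X - V} =
      {z \<in> topspace Z. (\<lambda>t\<in>{0..1}. h (t, z)) ` K \<subseteq> V}"
    using KV(2) by (auto simp: image_iff subset_iff)
  ultimately show "openin Z {z \<in> topspace Z. (\<lambda>t\<in>{0..1}. h (t, z)) ` K \<subseteq> V}"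
    by simp
qed

section \<open>Concatenation of paths\<close>

text \<open>Restricted to the unit interval, since elements of \<open>paths\<close> are extensional;
  at time \<open>1/2\<close> the value comes from the first path.\<close>

definition path_join :: "(real \<Rightarrow> 'a) \<Rightarrow> (real \<Rightarrow> 'a) \<Rightarrow> real \<Rightarrow> 'a" where
  "path_join \<alpha> \<beta> = (\<lambda>t\<in>{0..1}. if t \<le> 1/2 then \<alpha> (2 * t) else \<beta> (2 * t - 1))"

lemma path_join_paths:
  assumes "\<alpha> \<in> paths X" "\<beta> \<in> paths X" "\<alpha> 1 = \<beta> 0"
  shows "path_join \<alpha> \<beta> \<in> paths X"
proof -
  let ?I = "top_of_set {0..1::real}"
  have "continuous_map ?I X (\<lambda>t. if t \<le> 1/2 then (\<alpha> \<circ> (\<lambda>t. 2 * t)) t else (\<beta> \<circ> (\<lambda>t. 2 * t - 1)) t)"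
  proof (rule continuous_map_cases_le)
    have "continuous_map (subtopology ?I {t \<in> topspace ?I. t \<le> 1/2}) ?I (\<lambda>t. 2 * t)"
      by (auto simp: subtopology_subtopology intro!: continuous_intros)
    then show "continuous_map (subtopology ?I {t \<in> topspace ?I. t \<le> 1/2}) X (\<alpha> \<circ> (\<lambda>t. 2 * t))"
      using assms(1) by (auto simp: paths_def pathin_def intro: continuous_map_compose)
    have "continuous_map (subtopology ?I {t \<in> topspace ?I. 1/2 \<le> t}) ?I (\<lambda>t. 2 * t - 1)"
      by (auto simp: subtopology_subtopology intro!: continuous_intros)
    then show "continuous_map (subtopology ?I {t \<in> topspace ?I. 1/2 \<le> t}) X (\<beta> \<circ> (\<lambda>t. 2 * t - 1))"
      using assms(2) by (auto simp: paths_def pathin_def intro: continuous_map_compose)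
  next
    fix t :: real
    assume "t \<in> topspace ?I" "t = 1/2"
    with assms(3) show "(\<alpha> \<circ> (\<lambda>t. 2 * t)) t = (\<beta> \<circ> (\<lambda>t. 2 * t - 1)) t"
      by (simp only: o_apply) simp
  qed auto
  then show ?thesis
    by (auto simp: path_join_def paths_def pathin_def elim: continuous_map_eq)
qed

text \<open>The maps \<open>t / 2\<close> and \<open>(t + 1) / 2\<close> undo the two
  reparametrisations, so pulling \<open>K\<close> back along them gives the times at which each path
  is visited. One generator condition on the join thus splits into one on each path.\<close>

lemma path_join_image_subset:
  fixes K :: "real set"
  assumes "K \<subseteq> {0..1}" and "\<alpha> 1 = \<beta> 0"
  shows "path_join \<alpha> \<beta> ` K \<subseteq> V \<longleftrightarrow>
    \<alpha> ` ({0..1} \<inter> (\<lambda>t. t / 2) -` K) \<subseteq> V \<and> \<beta> ` ({0..1} \<inter> (\<lambda>t. (t + 1) / 2) -` K) \<subseteq> V"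
proof safe
  fix t :: real assume *: "path_join \<alpha> \<beta> ` K \<subseteq> V" "t \<in> {0..1}"
  show "\<alpha> t \<in> V" if "t / 2 \<in> K"
    using * subsetD[OF *(1) imageI[OF that]] by (simp add: path_join_def)
  show "\<beta> t \<in> V" if "(t + 1) / 2 \<in> K"
  \<comment> \<open>At \<open>t = 0\<close> the join is evaluated at \<open>1/2\<close>, where it
    uses \<open>\<alpha>\<close>; the matching condition \<open>\<alpha> 1 = \<beta> 0\<close>
    bridges the gap.\<close>
  proof (cases "t = 0")
    case True
    then show ?thesis
      using * subsetD[OF *(1) imageI[OF that]] assms(2) by (simp add: path_join_def)
  next
    case False
    moreover have "2 * ((t + 1) / 2) - 1 = t"
      by (simp add: field_simps)
    ultimately show ?thesis
      using * subsetD[OF *(1) imageI[OF that]] by (simp add: path_join_def del: divide_eq_eq)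
  qed
next
  fix t :: real assume \<alpha>: "\<alpha> ` ({0..1} \<inter> (\<lambda>t. t / 2) -` K) \<subseteq> V"
    and \<beta>: "\<beta> ` ({0..1} \<inter> (\<lambda>t. (t + 1) / 2) -` K) \<subseteq> V" and t: "t \<in> K"
  show "path_join \<alpha> \<beta> t \<in> V"
  proof (cases "t \<le> 1/2")
    case True
    then show ?thesis
      using subsetD[OF \<alpha> imageI, of "2 * t"] t assms(1) by (auto simp: path_join_def)
  next
    case False
    then show ?thesis
      using subsetD[OF \<beta> imageI, of "2 * t - 1"] t assms(1) by (auto simp: path_join_def)
  qed
qed

lemma continuous_map_path_join:
  assumes a: "continuous_map Z (path_space X) a" and b: "continuous_map Z (path_space X) b"
    and ab: "\<And>z. z \<in> topspace Z \<Longrightarrow> a z 1 = b z 0"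
  shows "continuous_map Z (path_space X) (\<lambda>z. path_join (a z) (b z))"
proof (rule continuous_map_into_path_space)
  show "path_join (a z) (b z) \<in> paths X" if "z \<in> topspace Z" for z
    using that ab continuous_map_funspace[OF a] continuous_map_funspace[OF b]
    by (intro path_join_paths) (auto simp: topspace_path_space)
next
  fix K :: "real set" and V
  assume KV: "compact K" "K \<subseteq> {0..1}" "openin X V"
  let ?K1 = "{0..1} \<inter> (\<lambda>t. t / 2) -` K" and ?K2 = "{0..1} \<inter> (\<lambda>t. (t + 1) / 2) -` K"
  \<comment> \<open>Both time sets are closed in the unit interval, hence compact, so they again
    define generators.\<close>
  have "closed ((\<lambda>t. t / 2) -` K)" "closed ((\<lambda>t. (t + 1) / 2) -` K)"
    by (intro closed_vimage continuous_intros compact_imp_closed KV(1); simp)+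
  then have "compact ?K1" "compact ?K2"
    by (blast intro: compact_Int_closed compact_Icc)+
  then have "openin Z ({z \<in> topspace Z. a z ` ?K1 \<subseteq> V} \<inter> {z \<in> topspace Z. b z ` ?K2 \<subseteq> V})"
    using a b KV(3) by (intro openin_Int openin_path_space_preimage) auto
  moreover
  have "path_join (a z) (b z) ` K \<subseteq> V \<longleftrightarrow> a z ` ?K1 \<subseteq> V \<and> b z ` ?K2 \<subseteq> V"
    if "z \<in> topspace Z" for z
    using KV(2) ab[OF that] by (rule path_join_image_subset)
  then have "{z \<in> topspace Z. path_join (a z) (b z) ` K \<subseteq> V} =
      {z \<in> topspace Z. a z ` ?K1 \<subseteq> V} \<inter> {z \<in> topspace Z. b z ` ?K2 \<subseteq> V}"
    by (simp only: set_eq_iff mem_Collect_eq Int_iff) metis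
  ultimately show "openin Z {z \<in> topspace Z. path_join (a z) (b z) ` K \<subseteq> V}"
    by simp
qed

section \<open>Transport of motion plans\<close>

text \<open>The pullback lemma is applied along \<open>u\<close> times the identity of
  \<open>Y\<close>; the work lies in lifting a section over \<open>C\<close> to one over its
  preimage.\<close>

lemma TC_le_if_homotopy_retract:
  fixes X :: "'a topology" and X' :: "'b topology" and Y :: "'c topology"
  assumes u: "fibrewise_map X f X' f' u" and v: "fibrewise_map X' f' X f v"
    and vu: "homotopic_with (\<lambda>_. True) X X (v \<circ> u) id"
  shows "TC X Y f \<le> TC X' Y f'"
  unfolding TC_def
proof (rule sectional_number_le_pullback[where g = "\<lambda>(x, y). (u x, y)"])
  have cu: "continuous_map X X' u" and cv: "continuous_map X' X v"
    using u v by (auto simp: fibrewise_map_def)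
  let ?g = "\<lambda>(x, y). (u x, y)"
  show g: "continuous_map (prod_topology X Y) (prod_topology X' Y) ?g"
    using cu by (auto simp: case_prod_unfold continuous_map_pairwise o_def continuous_map_snd
      intro: continuous_map_compose[OF continuous_map_fst, unfolded o_def])
  \<comment> \<open>The homotopy is reversed so that its tracks start at \<open>x\<close> and end at
    \<open>v (u x)\<close>.\<close>
  obtain h where h: "continuous_map (prod_topology (top_of_set {0..1::real}) X) X h"
    and h0: "\<forall>x. h (0, x) = x" and h1: "\<forall>x. h (1, x) = v (u x)"
    using homotopic_with_symD[OF vu] by (auto simp: homotopic_with_def)
  fix C s'
  assume s': "continuous_map (subtopology (prod_topology X' Y) C) (path_space X') s'"
    and sec: "\<forall>b\<in>C. (s' b 0, f' (s' b 1)) = b"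
  let ?D = "{b \<in> topspace (prod_topology X Y). ?g b \<in> C}"
  let ?Z = "subtopology (prod_topology X Y) ?D"
  \<comment> \<open>For \<open>z = (x, y)\<close>, \<open>a z\<close> is the track of
    \<open>x\<close> under \<open>h\<close>, and \<open>b z\<close> is the \<open>v\<close>-image of
    the path planned for \<open>(u x, y)\<close>.\<close>
  define a where "a = (\<lambda>z :: 'a \<times> 'c. \<lambda>t\<in>{0..1}. h (t, fst z))"
  define b where "b = (\<lambda>z. \<lambda>t\<in>{0..1}. v (s' (?g z) t))"
  have "continuous_map ?Z X fst"
    by (intro continuous_map_from_subtopology continuous_map_fst)
  from continuous_map_compose[OF this continuous_map_path_space_curry[OF h]]
  have a: "continuous_map ?Z (path_space X) a"
    by (simp add: a_def o_def)
  have "continuous_map ?Z (subtopology (prod_topology X' Y) C) ?g"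
    using g by (auto simp: continuous_map_in_subtopology continuous_map_from_subtopology)
  from continuous_map_compose[OF continuous_map_compose[OF this s']
      continuous_map_path_space_compose[OF cv]]
  have b: "continuous_map ?Z (path_space X) b"
    by (simp add: b_def o_def)
  \<comment> \<open>The two coordinates of the section equation: the first makes the paths match,
    the second controls the endpoint.\<close>
  have start: "s' (?g z) 0 = u (fst z)" and finish: "f' (s' (?g z) 1) = snd z" if "z \<in> ?D" for z
    using sec that by (auto simp: case_prod_unfold dest!: bspec)
  \<comment> \<open>The identity \<open>f (v x') = f' x'\<close> is available only on
    \<open>topspace X'\<close>, so the planned endpoint has to be placed there.\<close>
  have end_in: "s' (?g z) 1 \<in> topspace X'" if "z \<in> ?D" for z
  proof -
    have "?g z \<in> topspace (subtopology (prod_topology X' Y) C)"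
      using that continuous_map_funspace[OF cu] by auto
    then have "s' (?g z) \<in> paths X'"
      using continuous_map_funspace[OF s'] by (auto simp: topspace_path_space)
    then show ?thesis
      by (auto simp: paths_def pathin_def continuous_map_def)
  qed
  have "continuous_map ?Z (path_space X) (\<lambda>z. path_join (a z) (b z))"
    using a b
  proof (rule continuous_map_path_join)
    fix z assume "z \<in> topspace ?Z"
    \<comment> \<open>Both sides equal \<open>v (u (fst z))\<close>.\<close>
    then show "a z 1 = b z 0"
      using start[of z] by (auto simp: a_def b_def h1)
  qed
  \<comment> \<open>The end of the join is \<open>v\<close> of the planned endpoint; applying
    \<open>f\<close> gives \<open>f'\<close> of that endpoint, which is
    \<open>snd z\<close>.\<close>
  moreover have "(path_join (a z) (b z) 0, f (path_join (a z) (b z) 1)) = z" if "z \<in> ?D" for z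
    using that v finish[OF that] end_in[OF that]
    by (auto simp: path_join_def a_def b_def h0 fibrewise_map_def)
  ultimately show "\<exists>s. continuous_map ?Z (path_space X) s \<and>
      (\<forall>z \<in> topspace (prod_topology X Y). ?g z \<in> C \<longrightarrow> (s z 0, f (s z 1)) = z)"
    by blast
qed

section \<open>Invariance of topological complexity\<close>

theorem corollary3p9:
  fixes X :: "'a topology" and X' :: "'b topology" and Y :: "'c topology"
    and f :: "'a \<Rightarrow> 'c" and f' :: "'b \<Rightarrow> 'c"
  assumes "metric_ANR X" and "metric_ANR X'" and "metric_ANR Y"
    and "path_connected_space X" and "path_connected_space X'" and "path_connected_space Y"
    and "continuous_surjection X Y f" and "continuous_surjection X' Y f'"
  shows "(\<forall>u v. fibrewise_map X f X' f' u \<and> fibrewise_map X' f' X f v \<and>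
            homotopic_with (\<lambda>_. True) X X (v \<circ> u) id \<and>
            homotopic_with (\<lambda>_. True) X' X' (u \<circ> v) id \<longrightarrow>
            TC X Y f = TC X' Y f') \<and>
         (fibre_homotopy_equivalent X f X' f' \<longrightarrow> TC X Y f = TC X' Y f')"
proof -
  have main: "TC X Y f = TC X' Y f'"
    if "fibrewise_map X f X' f' u" "fibrewise_map X' f' X f v"
      "homotopic_with (\<lambda>_. True) X X (v \<circ> u) id" "homotopic_with (\<lambda>_. True) X' X' (u \<circ> v) id"
    for u v
    \<comment> \<open>The reverse inequality is the same lemma with the roles of \<open>u\<close>
      and \<open>v\<close> exchanged.\<close>
    using that by (intro antisym TC_le_if_homotopy_retract)
  moreover have "TC X Y f = TC X' Y f'" if "fibre_homotopy_equivalent X f X' f'"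
    using that unfolding fibre_homotopy_equivalent_def
    \<comment> \<open>Fibre-preserving homotopies are in particular homotopies, by weakening the
      condition on the stages.\<close>
    by (auto intro: main homotopic_with_mono)
  ultimately show ?thesis
    by blast
qed

end
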